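(* Let $G$ be a finite group. Then $\mathcal{RP}^*(G)$ is claw-free if and only if $\pi_e(G)\subseteq\{1,4\}\cup\mathbb P$ and any two distinct cyclic subgroups of order $4$ in $G$ intersect trivially.
   Context: For a group $G$ with identity $e$, the reduced power graph $\mathcal{RP}(G)$ is the simple graph with vertex set $G$ in which $u,v$ are adjacent if and only if $\langle v\rangle\subset\langle u\rangle$ or $\langle u\rangle\subset\langle v\rangle$, where $\subset$ means proper inclusion. The proper reduced power graph $\mathcal{RP}^*(G)$ is the subgraph of $\mathcal{RP}(G)$ induced on $G\setminus\{e\}$. $\pi_e(G)$ denotes the set of orders of elements of $G$, and $\mathbb P$ the set of all prime numbers. A graph is claw-free if it has no induced subgraph isomorphic to $K_{1,3}$. *)

theory Defs
  imports "HOL-Algebra.Algebra" "Graph_Theory.Graph_Theory"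
begin

text \<open>A simple graph is represented, as in the theory of digraphs used here, by a symmetric
  irreflexive set of arcs.\<close>

definition reduced_power_graph :: "('a, 'b) monoid_scheme \<Rightarrow> ('a, 'a \<times> 'a) pre_digraph" where
  "reduced_power_graph G = with_proj
     \<lparr> pverts = carrier G,
       parcs = {(u, v). u \<in> carrier G \<and> v \<in> carrier G \<and>
                 (generate G {v} \<subset> generate G {u} \<or> generate G {u} \<subset> generate G {v})} \<rparr>"

definition proper_reduced_power_graph :: "('a, 'b) monoid_scheme \<Rightarrow> ('a, 'a \<times> 'a) pre_digraph" where
  "proper_reduced_power_graph G = reduced_power_graph G \<restriction> (carrier G - {\<one>\<^bsub>G\<^esub>})"

text \<open>The predicate \<open>K\<^bsub>1,3\<^esub> H\<close> holds of every graph \<open>H\<close> that is a copy of the complete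
  bipartite graph, so no separate isomorphism is needed.\<close>

definition claw_free :: "('a, 'b) pre_digraph \<Rightarrow> bool" where
  "claw_free \<Gamma> \<longleftrightarrow> \<not> (\<exists>H. induced_subgraph H \<Gamma> \<and> K\<^bsub>1,3\<^esub> H)"

definition element_orders :: "('a, 'b) monoid_scheme \<Rightarrow> nat set" where
  "element_orders G = group.ord G ` carrier G"

definition cyclic_subgroup :: "'a set \<Rightarrow> ('a, 'b) monoid_scheme \<Rightarrow> bool" where
  "cyclic_subgroup H G \<longleftrightarrow> subgroup H G \<and> cyclic_group (G\<lparr>carrier := H\<rparr>)"

lemma graph_reduced_power_graph:
  assumes "finite (carrier G)"
  shows "graph (reduced_power_graph G)"
proof -
  let ?P = "\<lparr> pverts = carrier G,
       parcs = {(u, v). u \<in> carrier G \<and> v \<in> carrier G \<and>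
                 (generate G {v} \<subset> generate G {u} \<or> generate G {u} \<subset> generate G {v})} \<rparr>"
  have "finite (parcs ?P)"
    by (rule finite_subset[of _ "carrier G \<times> carrier G"]) (use assms in auto)
  then interpret pair_graph ?P
    by unfold_locales (use assms in \<open>auto simp: symmetric_def intro!: symI\<close>)
  show ?thesis
    unfolding reduced_power_graph_def by unfold_locales
qed

end

theory Submission
  imports Defs
begin

text \<open>
  A claw is a vertex \<open>c\<close> with three distinct, pairwise non-adjacent neighbours. In a finite group,
  \<open>\<langle>a\<rangle> \<subset> \<langle>b\<rangle>\<close> holds iff \<open>a \<in> \<langle>b\<rangle>\<close> and the orders of \<open>a\<close> and \<open>b\<close> differ
  (\<open>generate_psubset_iff\<close>); then \<open>ord a\<close> properly divides \<open>ord b\<close>. Hence elements whose orders are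
  equal, or incomparable for divisibility, are not adjacent in the proper reduced power graph
  (\<open>not_claw_freeI\<close>).

  Suppose that \<open>g\<close> has composite order \<open>n \<noteq> 4\<close>. If \<open>n \<noteq> 6\<close>, then \<open>\<int>/n\<close> has a unit \<open>k\<close> other than
  \<open>\<plusminus>1\<close> (\<open>ex_nontrivial_unit\<close>), so \<open>g\<close>, \<open>g\<^sup>k\<close> and \<open>g\<^sup>n\<^sup>-\<^sup>1\<close> are three distinct generators of \<open>\<langle>g\<rangle>\<close>,
  and any \<open>g\<^sup>d\<close> with \<open>d\<close> a proper nontrivial divisor of \<open>n\<close> is the centre of a claw with these leaves.
  If \<open>n = 6\<close>, then \<open>g\<close> itself is the centre of a claw, with leaves \<open>g\<^sup>2\<close>, \<open>g\<^sup>4\<close> and \<open>g\<^sup>3\<close>. If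
  distinct cyclic subgroups \<open>\<langle>x\<rangle>\<close> and \<open>\<langle>y\<rangle>\<close> of order 4 share an element \<open>w \<noteq> \<one>\<close>, then \<open>w\<close> is the
  centre of a claw with leaves \<open>x\<close>, \<open>x\<^sup>3\<close> and \<open>y\<close>.

  Conversely, if all orders are 1, 4 or prime, then adjacent vertices have orders 2 and 4. An element
  of order 4 has its square as only neighbour. All neighbours of an element of order 2 have order 4;
  by the intersection condition they generate one and the same subgroup, which has only two generators.
  Hence every vertex has degree at most 2, and there is no claw.
\<close>

section \<open>Claws in graphs\<close>

lemma arcs_ends_induced_subgraph:
  assumes "induced_subgraph H \<Gamma>"
  shows "arcs_ends H = {(u, v) \<in> arcs_ends \<Gamma>. u \<in> verts H \<and> v \<in> verts H}"
  using assms
  by (auto simp: induced_subgraph_def subgraph_def compatible_def arcs_ends_def arc_to_ends_def)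

lemma (in graph) graph_induce_subgraph:
  assumes "S \<subseteq> verts G"
  shows "graph (G \<restriction> S)"
proof -
  have ind: "induced_subgraph (G \<restriction> S) G" by (rule induced_induce[OF assms])
  interpret D: digraph "G \<restriction> S" by (rule digraphI_induced[OF ind])
  interpret S: sym_digraph "G \<restriction> S" by (rule induced_graph_imp_graph[OF ind])
  show ?thesis by unfold_locales
qed

lemma (in graph) claw_free_iff:
  "claw_free G \<longleftrightarrow>
     \<not> (\<exists>c x y z. c \<rightarrow> x \<and> c \<rightarrow> y \<and> c \<rightarrow> z \<and> distinct [x, y, z]
           \<and> \<not> x \<rightarrow> y \<and> \<not> y \<rightarrow> z \<and> \<not> x \<rightarrow> z)"
  (is "_ \<longleftrightarrow> \<not> ?claw")
proof -
  have "(\<exists>H. induced_subgraph H G \<and> K\<^bsub>1,3\<^esub> H) \<longleftrightarrow> ?claw"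
  proof
    assume "\<exists>H. induced_subgraph H G \<and> K\<^bsub>1,3\<^esub> H"
    then obtain H U V where H: "induced_subgraph H G" and UV: "verts H = U \<union> V" "U \<inter> V = {}"
      "card U = 1" "card V = 3" "arcs_ends H = U \<times> V \<union> V \<times> U"
      by (auto simp: complete_bipartite_digraph_def)
    from UV(3,4) obtain c x y z where c: "U = {c}" and xyz: "V = {x, y, z}" "distinct [x, y, z]"
      by (auto simp: card_1_singleton_iff card_3_iff)
    have ends: "arcs_ends H = {(u, v) \<in> arcs_ends G. u \<in> verts H \<and> v \<in> verts H}"
      by (rule arcs_ends_induced_subgraph[OF H])
    have "u \<rightarrow> v \<longleftrightarrow> (u, v) \<in> U \<times> V \<union> V \<times> U" if "u \<in> U \<union> V" "v \<in> U \<union> V" for u v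
      using that UV(1,5) ends by blast
    then have "c \<rightarrow> x \<and> c \<rightarrow> y \<and> c \<rightarrow> z \<and> \<not> x \<rightarrow> y \<and> \<not> y \<rightarrow> z \<and> \<not> x \<rightarrow> z"
      using c xyz UV(2) by auto
    then show ?claw using xyz(2) by blast
  next
    assume ?claw
    then obtain c x y z where adj: "c \<rightarrow> x" "c \<rightarrow> y" "c \<rightarrow> z"
      and xyz: "distinct [x, y, z]" and nadj: "\<not> x \<rightarrow> y" "\<not> y \<rightarrow> z" "\<not> x \<rightarrow> z"
      by blast
    let ?S = "{c, x, y, z}"
    have S: "?S \<subseteq> verts G" using adj by auto
    have ind: "induced_subgraph (G \<restriction> ?S) G" by (rule induced_induce[OF S])
    have irr: "\<not> u \<rightarrow> u" for u using adj_not_same by blast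
    have symm: "u \<rightarrow> v \<longleftrightarrow> v \<rightarrow> u" for u v using arcs_ends_symmetric[OF sym_arcs] by blast
    have "arcs_ends (G \<restriction> ?S) = {c} \<times> {x, y, z} \<union> {x, y, z} \<times> {c}"
      unfolding arcs_ends_induced_subgraph[OF ind]
      using adj nadj irr symm by auto
    moreover have "{c} \<inter> {x, y, z} = {}" using adj irr by auto
    moreover have "verts (G \<restriction> ?S) = {c} \<union> {x, y, z}" by auto
    moreover have "card {c} = 1" "card {x, y, z} = 3" using xyz by auto
    moreover have "graph (G \<restriction> ?S)" by (rule graph_induce_subgraph[OF S])
    ultimately have "K\<^bsub>1,3\<^esub> (G \<restriction> ?S)"
      unfolding complete_bipartite_digraph_def by blast
    then show "\<exists>H. induced_subgraph H G \<and> K\<^bsub>1,3\<^esub> H" using ind by blast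
  qed
  then show ?thesis unfolding claw_free_def by simp
qed

section \<open>Units modulo \<open>n\<close>\<close>

text \<open>The residues \<open>1\<close> and \<open>n - 1\<close> are units modulo \<open>n\<close>. A further one is \<open>2\<close> for odd \<open>n\<close>; for \<open>n = 2m\<close>
  it is \<open>m + 2\<close> or \<open>m + 1\<close>, whichever is odd.\<close>

lemma ex_nontrivial_unit:
  fixes n :: nat
  assumes "n \<ge> 5" and "n \<noteq> 6"
  shows "\<exists>k. 1 < k \<and> k < n - 1 \<and> coprime n k"
proof (cases "odd n")
  case True
  then have "coprime n 2" by simp
  then show ?thesis using assms by (intro exI[of _ 2]) auto
next
  case False
  then obtain m where m: "n = 2 * m" by (auto elim: evenE)
  show ?thesis
  proof (cases "odd m")
    case True
    have "gcd m (m + 2) = gcd m 2" by (simp only: gcd_add2)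
    also have "\<dots> = 1" using True by (simp add: coprime_right_2_iff_odd)
    finally have "coprime m (m + 2)" by (simp add: coprime_iff_gcd_eq_1)
    moreover have "coprime 2 (m + 2)" using True by simp
    ultimately have "coprime n (m + 2)" using m by simp
    moreover have "m \<noteq> 3" "m \<noteq> 4" "m \<ge> 3" using assms m True by auto
    ultimately show ?thesis using m by (intro exI[of _ "m + 2"]) auto
  next
    case False
    have "coprime m (m + 1)" by simp
    moreover have "coprime 2 (m + 1)" using False by simp
    ultimately have "coprime n (m + 1)" using m by simp
    then show ?thesis using assms m by (intro exI[of _ "m + 1"]) auto
  qed
qed

section \<open>The proper reduced power graph\<close>

lemma arc_proper_reduced_power_graph_iff:
  "u \<rightarrow>\<^bsub>proper_reduced_power_graph G\<^esub> v \<longleftrightarrow>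
     u \<in> carrier G - {\<one>\<^bsub>G\<^esub>} \<and> v \<in> carrier G - {\<one>\<^bsub>G\<^esub>} \<and>
     (generate G {u} \<subset> generate G {v} \<or> generate G {v} \<subset> generate G {u})"
  by (auto simp: proper_reduced_power_graph_def reduced_power_graph_def arcs_ends_def
      arc_to_ends_def image_iff)

lemma graph_proper_reduced_power_graph:
  assumes "group G" "finite (carrier G)"
  shows "graph (proper_reduced_power_graph G)"
proof -
  interpret graph "reduced_power_graph G" by (rule graph_reduced_power_graph[OF assms(2)])
  have "carrier G - {\<one>\<^bsub>G\<^esub>} \<subseteq> verts (reduced_power_graph G)"
    by (auto simp: reduced_power_graph_def)
  then show ?thesis unfolding proper_reduced_power_graph_def by (rule graph_induce_subgraph)
qed

context group
begin

section \<open>Cyclic subgroups and orders\<close>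

lemma cyclic_subgroup_iff:
  "cyclic_subgroup H G \<longleftrightarrow> (\<exists>x\<in>carrier G. H = generate G {x})"
proof -
  have "cyclic_group (G\<lparr>carrier := H\<rparr>) \<longleftrightarrow> (\<exists>x\<in>H. H = generate G {x})" if H: "subgroup H G"
  proof -
    interpret H: group "G\<lparr>carrier := H\<rparr>" by (rule subgroup_imp_group[OF H])
    have "range (\<lambda>n::int. x [^]\<^bsub>G\<lparr>carrier := H\<rparr>\<^esub> n) = generate G {x}" if "x \<in> H" for x
      using that generate_pow[of x] int_pow_consistent[OF H that] subgroup.mem_carrier[OF H]
      by (auto simp: image_def)
    then show ?thesis by (simp add: H.cyclic_group)
  qed
  then show ?thesis
    unfolding cyclic_subgroup_def
    by (metis empty_subsetI generate.incl generate_is_subgroup insert_subset insertI1 subgroup.mem_carrier)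
qed

lemma generate_subset_iff:
  assumes "a \<in> carrier G" "b \<in> carrier G"
  shows "generate G {a} \<subseteq> generate G {b} \<longleftrightarrow> a \<in> generate G {b}"
  using assms generate_subgroup_incl[of "{a}" "generate G {b}"] generate_is_subgroup[of "{b}"]
    generate.incl[of a "{a}" G] by auto

lemma ord_dvd_if_in_generate:
  assumes "a \<in> generate G {b}" "b \<in> carrier G"
  shows "ord a dvd ord b"
proof -
  obtain k :: int where k: "a = b [^] k" using assms generate_pow by auto
  have "a [^] int (ord b) = (b [^] int (ord b)) [^] k"
    using assms(2) k by (simp add: int_pow_pow mult.commute del: int_pow_int)
  also have "\<dots> = \<one>" using assms(2) by (simp add: int_pow_int)
  finally show ?thesis using assms(2) k by (simp add: int_pow_int pow_eq_id)
qed

lemma generate_eq_if_ord_eq: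
  assumes "finite (carrier G)" "a \<in> carrier G" "b \<in> carrier G"
    and "a \<in> generate G {b}" "ord a = ord b"
  shows "generate G {a} = generate G {b}"
proof (rule card_subset_eq)
  show "finite (generate G {b})"
    using assms(1,3) generate_incl[of "{b}"] by (auto intro: finite_subset)
  show "generate G {a} \<subseteq> generate G {b}"
    using assms generate_subset_iff by simp
  show "card (generate G {a}) = card (generate G {b})"
    using assms by (simp flip: generate_pow_card)
qed

lemma generate_psubset_iff:
  assumes "finite (carrier G)" "a \<in> carrier G" "b \<in> carrier G"
  shows "generate G {a} \<subset> generate G {b} \<longleftrightarrow> a \<in> generate G {b} \<and> ord a \<noteq> ord b"
  using assms generate_subset_iff[of a b] generate_eq_if_ord_eq[of a b] generate_pow_card
  by (auto simp: psubset_eq)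

lemma pow_mem_generate:
  assumes "x \<in> carrier G"
  shows "x [^] (k::nat) \<in> generate G {x}"
  using assms generate_pow[of x] int_pow_int[of G x k] by (auto intro!: exI[of _ "int k"])

section \<open>Claws forced by the structure of the group\<close>

text \<open>The leaves are recognised as pairwise non-adjacent by their orders alone.\<close>

lemma not_claw_freeI:
  assumes fin: "finite (carrier G)"
    and "{c, x, y, z} \<subseteq> carrier G - {\<one>}" "distinct [x, y, z]"
    and "generate G {c} \<subset> generate G {x} \<or> generate G {x} \<subset> generate G {c}"
    and "generate G {c} \<subset> generate G {y} \<or> generate G {y} \<subset> generate G {c}"
    and "generate G {c} \<subset> generate G {z} \<or> generate G {z} \<subset> generate G {c}"
    and "ord x = ord y \<or> \<not> ord x dvd ord y \<and> \<not> ord y dvd ord x"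
    and "ord y = ord z \<or> \<not> ord y dvd ord z \<and> \<not> ord z dvd ord y"
    and "ord x = ord z \<or> \<not> ord x dvd ord z \<and> \<not> ord z dvd ord x"
  shows "\<not> claw_free (proper_reduced_power_graph G)"
proof -
  interpret P: graph "proper_reduced_power_graph G"
    by (rule graph_proper_reduced_power_graph[OF is_group fin])
  have adj: "c \<rightarrow>\<^bsub>proper_reduced_power_graph G\<^esub> x"
    "c \<rightarrow>\<^bsub>proper_reduced_power_graph G\<^esub> y" "c \<rightarrow>\<^bsub>proper_reduced_power_graph G\<^esub> z"
    using assms(2,4-6) by (simp_all add: arc_proper_reduced_power_graph_iff)
  have *: "ord a \<noteq> ord b \<and> (ord a dvd ord b \<or> ord b dvd ord a)"
    if "a \<rightarrow>\<^bsub>proper_reduced_power_graph G\<^esub> b" for a b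
  proof -
    have ab: "a \<in> carrier G" "b \<in> carrier G"
      and "generate G {a} \<subset> generate G {b} \<or> generate G {b} \<subset> generate G {a}"
      using that by (simp_all add: arc_proper_reduced_power_graph_iff)
    then show ?thesis
      using generate_psubset_iff[OF fin ab] generate_psubset_iff[OF fin ab(2,1)]
        ord_dvd_if_in_generate[OF _ ab(1)] ord_dvd_if_in_generate[OF _ ab(2)] by metis
  qed
  have "\<not> x \<rightarrow>\<^bsub>proper_reduced_power_graph G\<^esub> y" "\<not> y \<rightarrow>\<^bsub>proper_reduced_power_graph G\<^esub> z"
    "\<not> x \<rightarrow>\<^bsub>proper_reduced_power_graph G\<^esub> z"
    using *[of x y] *[of y z] *[of x z] assms(7-) by blast+
  then show ?thesis unfolding P.claw_free_iff using adj assms(3) by blast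
qed

lemma pow_eq_pow_imp_eq:
  assumes "x \<in> carrier G" "i < ord x" "j < ord x" "x [^] (i::nat) = x [^] j"
  shows "i = j"
  using inj_onD[OF ord_inj[OF assms(1)] assms(4)] assms(2,3) by auto

lemma not_claw_free_if_ord_composite:
  assumes fin: "finite (carrier G)" and g: "g \<in> carrier G"
    and n: "ord g \<noteq> 1" "ord g \<noteq> 4" "\<not> Factorial_Ring.prime (ord g)"
  shows "\<not> claw_free (proper_reduced_power_graph G)"
proof (cases "ord g = 6")
  case True
  have ords: "ord (g [^] (2::nat)) = 3" "ord (g [^] (3::nat)) = 2" "ord (g [^] (4::nat)) = 3"
    using g True by (simp_all add: ord_pow_gen gcd_non_0_nat)
  have mem: "g [^] (k::nat) \<in> carrier G" for k using g by simp
  have ne1: "g \<noteq> \<one>" "g [^] (2::nat) \<noteq> \<one>" "g [^] (3::nat) \<noteq> \<one>" "g [^] (4::nat) \<noteq> \<one>"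
    using ords True ord_id by (metis numeral_eq_one_iff semiring_norm(85,86))+
  have "g [^] (2::nat) \<noteq> g [^] (4::nat)"
    using pow_eq_pow_imp_eq[OF g, of 2 4] True by auto
  then show ?thesis
    using ords True ne1 g mem
    by (intro not_claw_freeI[OF fin, of g "g [^] (2::nat)" "g [^] (4::nat)" "g [^] (3::nat)"])
      (auto simp: generate_psubset_iff[OF fin] pow_mem_generate)
next
  case False
  let ?n = "ord g"
  have pos: "?n > 0" using ord_ge_1[OF fin g] by simp
  obtain d where d: "d dvd ?n" "d \<noteq> 1" "d \<noteq> ?n"
    using n(1,3) pos by (metis One_nat_def prime_nat_iff nat_neq_iff less_one)
  have d0: "d \<noteq> 0" using d pos by auto
  have n5: "?n \<ge> 5"
  proof -
    have "?n \<noteq> 2" "?n \<noteq> 3" using n(3) by auto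
    then show ?thesis using n(1,2) pos by linarith
  qed
  then obtain k where k: "1 < k" "k < ?n - 1" "coprime ?n k"
    using ex_nontrivial_unit[of ?n] False by blast
  \<comment> \<open>The centre of the claw: neither trivial nor a generator of the group generated by \<open>g\<close>.\<close>
  let ?h = "g [^] d"
  have ord_h: "ord ?h = ?n div d" using ord_pow[OF g d(1) d0] .
  then have h: "ord ?h \<noteq> ?n" "ord ?h \<noteq> 1"
    using d d0 pos by (auto elim!: dvdE)
  have gen: "generate G {g [^] j} = generate G {g}" "ord (g [^] j) = ?n"
    if "coprime ?n j" "j \<noteq> 0" for j
  proof -
    show "ord (g [^] j) = ?n" using that g by (simp add: ord_pow_gen)
    then show "generate G {g [^] j} = generate G {g}"
      using g fin by (intro generate_eq_if_ord_eq pow_mem_generate) auto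
  qed
  have cop: "coprime ?n (?n - 1)" using pos
    by (metis Suc_diff_1 coprime_Suc_left_nat)
  note gens = gen[OF k(3)] gen[OF cop]
  have lt: "generate G {?h} \<subset> generate G {g}"
    using g h pow_mem_generate generate_psubset_iff[OF fin] by simp
  have "g [^] (1::nat) \<noteq> g [^] k" "g [^] (1::nat) \<noteq> g [^] (?n - 1)" "g [^] k \<noteq> g [^] (?n - 1)"
    using pow_eq_pow_imp_eq[OF g, of 1 k] pow_eq_pow_imp_eq[OF g, of 1 "?n - 1"]
      pow_eq_pow_imp_eq[OF g, of k "?n - 1"] k n5 by linarith+
  then have dist: "distinct [g, g [^] k, g [^] (?n - 1)]" using g by simp
  have ne1: "x \<noteq> \<one>" if "ord x \<noteq> 1" for x using that by auto
  show ?thesis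
    using dist lt gens k n5 h g ne1[of ?h] ne1[of g] ne1[of "g [^] k"] ne1[of "g [^] (?n - 1)"]
    by (intro not_claw_freeI[OF fin, of ?h g "g [^] k" "g [^] (?n - 1)"]) auto
qed

lemma not_claw_free_if_generate_inter:
  assumes fin: "finite (carrier G)" and xy: "x \<in> carrier G" "y \<in> carrier G"
    and ords: "ord x = 4" "ord y = 4" and ne: "generate G {x} \<noteq> generate G {y}"
    and w: "w \<in> generate G {x}" "w \<in> generate G {y}" "w \<noteq> \<one>"
  shows "\<not> claw_free (proper_reduced_power_graph G)"
proof -
  have wc: "w \<in> carrier G" using w(1) xy(1) generate_incl[of "{x}"] by auto
  have "ord w \<noteq> 4"
    using generate_eq_if_ord_eq[OF fin wc, of x] generate_eq_if_ord_eq[OF fin wc, of y]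
      xy ords ne w by auto
  then have lt: "generate G {w} \<subset> generate G {x}" "generate G {w} \<subset> generate G {y}"
    using generate_psubset_iff[OF fin wc] xy w ords by auto
  let ?x3 = "x [^] (3::nat)"
  have ord3: "ord ?x3 = 4" using xy ords by (simp add: ord_pow_gen gcd_non_0_nat)
  then have gen3: "generate G {?x3} = generate G {x}"
    using generate_eq_if_ord_eq[OF fin, of ?x3 x] xy ords pow_mem_generate by simp
  have "x \<noteq> ?x3" using pow_eq_pow_imp_eq[of x 1 3] xy ords by auto
  then have dist: "distinct [x, ?x3, y]" using gen3 ne by auto
  have ne1: "u \<noteq> \<one>" if "ord u = 4" for u using that by auto
  show ?thesis
    by (rule not_claw_freeI[OF fin _ dist, of w])
      (use lt gen3 wc w xy ords ord3 ne1[of x] ne1[of y] ne1[of ?x3] in auto)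
qed

section \<open>Groups without claws\<close>

lemma ord_four_cases:
  assumes x: "x \<in> carrier G" "ord x = 4" and y: "y \<in> generate G {x}"
  shows "ord y = 4 \<Longrightarrow> y = x \<or> y = x [^] (3::nat)"
    and "ord y = 2 \<Longrightarrow> y = x [^] (2::nat)"
proof -
  have "y \<in> {x [^] k | k. k \<in> {0 .. ord x - 1}}"
    using y trans[OF generate_pow_nat[of x] ord_elems_inf_carrier[of x]] x by simp
  then obtain k :: nat where k: "y = x [^] k" "k < 4" using x by auto
  have "k = 0 \<or> k = 1 \<or> k = 2 \<or> k = 3" using k by auto
  then show "ord y = 4 \<Longrightarrow> y = x \<or> y = x [^] (3::nat)"
    and "ord y = 2 \<Longrightarrow> y = x [^] (2::nat)"
    using k x by (auto simp: ord_pow_gen gcd_non_0_nat)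
qed

text \<open>The intersection condition appears here in terms of generators: two elements of order 4 whose
  cyclic subgroups share a nontrivial element generate the same subgroup. Pairwise non-adjacency of
  the leaves is not needed for the contradiction, since no vertex has three distinct neighbours.\<close>

lemma claw_freeI:
  assumes fin: "finite (carrier G)"
    and orders: "element_orders G \<subseteq> {1, 4} \<union> {p. Factorial_Ring.prime p}"
    and cyc: "\<And>x y w. \<lbrakk>x \<in> carrier G; y \<in> carrier G; ord x = 4; ord y = 4;
        w \<in> generate G {x}; w \<in> generate G {y}; w \<noteq> \<one>\<rbrakk> \<Longrightarrow> generate G {x} = generate G {y}"
  shows "claw_free (proper_reduced_power_graph G)"
proof -
  interpret P: graph "proper_reduced_power_graph G"
    by (rule graph_proper_reduced_power_graph[OF is_group fin])
  have ords: "ord u = 2 \<and> ord v = 4 \<and> u \<in> generate G {v}"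
    if "generate G {u} \<subset> generate G {v}" "u \<in> carrier G - {\<one>}" "v \<in> carrier G - {\<one>}" for u v
  proof -
    have uv: "u \<in> generate G {v}" "ord u \<noteq> ord v"
      using that generate_psubset_iff[OF fin] by auto
    have dvd: "ord u dvd ord v" using uv that ord_dvd_if_in_generate by auto
    have u: "ord u = 4 \<or> Factorial_Ring.prime (ord u)" "ord u \<noteq> 1"
      and v: "ord v = 4 \<or> Factorial_Ring.prime (ord v)"
      using that orders ord_eq_1 unfolding element_orders_def by blast+
    have v4: "ord v = 4" using v dvd u(2) uv(2) by (auto simp: prime_nat_iff)
    have "ord u \<le> 4" "ord u \<noteq> 3" using dvd v4 by (auto dest: dvd_imp_le)
    moreover have "ord u \<noteq> 0" using dvd v4 by (metis dvd_0_left zero_neq_numeral)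
    ultimately show ?thesis using u v4 uv by linarith
  qed
  show ?thesis
    unfolding P.claw_free_iff arc_proper_reduced_power_graph_iff
  proof (rule notI, elim exE conjE)
    fix c x y z
    assume mem: "c \<in> carrier G - {\<one>}" "x \<in> carrier G - {\<one>}" "y \<in> carrier G - {\<one>}"
      "z \<in> carrier G - {\<one>}"
      and adj: "generate G {c} \<subset> generate G {x} \<or> generate G {x} \<subset> generate G {c}"
        "generate G {c} \<subset> generate G {y} \<or> generate G {y} \<subset> generate G {c}"
        "generate G {c} \<subset> generate G {z} \<or> generate G {z} \<subset> generate G {c}"
      and dist: "distinct [x, y, z]"
    have nb: "(ord c = 2 \<and> ord u = 4 \<and> c \<in> generate G {u}) \<or>
        (ord c = 4 \<and> ord u = 2 \<and> u \<in> generate G {c})"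
      if "generate G {c} \<subset> generate G {u} \<or> generate G {u} \<subset> generate G {c}"
        "u \<in> carrier G - {\<one>}" for u
      using ords[of c u] ords[of u c] that mem(1) by blast
    note nbs = nb[OF adj(1) mem(2)] nb[OF adj(2) mem(3)] nb[OF adj(3) mem(4)]
    show False
    proof (cases "ord c = 4")
      case True
      then have "x = c [^] (2::nat)" "y = c [^] (2::nat)"
        using nbs ord_four_cases(2)[of c] mem by auto
      then show False using dist by simp
    next
      case False
      \<comment> \<open>Now \<open>c\<close> has order 2, and all its neighbours generate the same subgroup as \<open>x\<close>.\<close>
      have *: "u = x \<or> u = x [^] (3::nat)"
        if "u \<in> carrier G - {\<one>}" "ord u = 4" "c \<in> generate G {u}" for u
      proof -
        have "generate G {u} = generate G {x}"
          using cyc[of u x c] that nbs(1) False mem by auto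
        then have "u \<in> generate G {x}" using generate.incl[of u "{u}" G] by simp
        then show ?thesis using ord_four_cases(1)[of x u] that nbs(1) False mem by auto
      qed
      show False using *[of y] *[of z] nbs(2,3) False mem dist by auto
    qed
  qed
qed

end

theorem theorem3p3:
  fixes G :: "('a, 'b) monoid_scheme" (structure)
  assumes "group G" and "finite (carrier G)"
  shows "claw_free (proper_reduced_power_graph G) \<longleftrightarrow>
      element_orders G \<subseteq> {1, 4} \<union> {p. Factorial_Ring.prime p} \<and>
      (\<forall>H K. cyclic_subgroup H G \<and> card H = 4 \<and> cyclic_subgroup K G \<and> card K = 4 \<and> H \<noteq> K
         \<longrightarrow> H \<inter> K = {\<one>})"
    (is "?free \<longleftrightarrow> ?orders \<and> ?inter")
proof -
  interpret group G by (rule assms(1))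
  have inter_iff: "?inter \<longleftrightarrow> (\<forall>x\<in>carrier G. \<forall>y\<in>carrier G. ord x = 4 \<longrightarrow> ord y = 4 \<longrightarrow>
      generate G {x} \<noteq> generate G {y} \<longrightarrow> generate G {x} \<inter> generate G {y} = {\<one>})"
    unfolding cyclic_subgroup_iff by (auto simp: generate_pow_card)
  show ?thesis
  proof (intro iffI conjI)
    assume free: ?free
    show ?orders
      using not_claw_free_if_ord_composite[OF assms(2)] free
      unfolding element_orders_def by blast
    show ?inter
      unfolding inter_iff
      using not_claw_free_if_generate_inter[OF assms(2)] free generate.one by blast
  next
    assume "?orders \<and> ?inter"
    then show ?free
      unfolding inter_iff by (intro claw_freeI[OF assms(2)]) blast+
  qed
qed

end
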